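(* Let $m\ge1$ be an integer, $1\le p\le\infty$, and let $F$ be a Banach space in which $\ell_p$ is uniformly finitely representable. If $$\mathcal L({}^m\ell_1;F)=\mathcal L_{\mathrm{as}(r;1)}({}^m\ell_1;F)$$ for some $0<r<\infty$, then $r\ge r_{m,p}$, where $$r_{m,p}=\begin{cases}\dfrac{2p}{mp+2p-2}, & 1\le p\le 2,\\[8pt] \dfrac{2p}{mp+2}, & 2\le p\le\infty,\end{cases}$$ and for $p=\infty$ the second expression is understood as $r_{m,\infty}=2/m$.
   Context: All Banach spaces are over a fixed field $\mathbb K\in\{\mathbb R,\mathbb C\}$. $\mathcal L({}^mE;F)$ denotes the space of continuous $m$-linear maps $E\times\cdots\times E\to F$ with the usual operator norm. The weak $1$-norm of a finite family $(x_j)_{j=1}^N$ in a Banach space $E$ is $\|(x_j)_{j=1}^N\|_{w,1}=\sup_{\varphi\in B_{E^*}}\sum_{j=1}^N|\varphi(x_j)|$, where $B_{E^*}$ is the closed unit ball of the dual. For $0<r<\infty$, an operator $T\in\mathcal L({}^mE;F)$ is absolutely $(r;1)$-summing if there is $C\ge0$ such that $$\Bigl(\sum_{j=1}^N\|T(x_j^{(1)},\ldots,x_j^{(m)})\|^r\Bigr)^{1/r}\le C\prod_{q=1}^m\|(x_j^{(q)})_{j=1}^N\|_{w,1}$$ for every $N\in\mathbb N$ and all finite families $(x_j^{(q)})_{j=1}^N\subset E$, $1\le q\le m$. The class of such maps is $\mathcal L_{\mathrm{as}(r;1)}({}^mE;F)$. $\ell_p$ is uniformly finitely representable in a Banach space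 $F$ if there is a constant $D\ge1$ such that for every $n\in\mathbb N$ there is a linear isomorphism $J_n:\ell_p^n\to F_n$ onto a subspace $F_n\subset F$ with $\|J_n\|\le1$ and $\|J_n^{-1}\|\le D$. Here $\ell_p^n$ is $\mathbb K^n$ with the $\ell_p$-norm. *)

theory Defs
  imports "HOL-Analysis.Analysis"
begin

section \<open>The scalar field\<close>

text \<open>
  Up to isometric isomorphism, the instances of the following class are exactly the real field
  and the complex field with their usual absolute values: the second disjunct describes
  the elements \<open>a + b i\<close> with their modulus. (Completeness is part of \<open>banach\<close>; both fields
  have it, and it is listed only for convenience.)
\<close>

class real_or_complex = real_normed_field + banach +
  assumes real_or_complex:
    "(\<forall>x. \<exists>a. x = a *\<^sub>R 1) \<or>
     (\<exists>i. i * i = - 1 \<and> (\<forall>x. \<exists>a b. x = a *\<^sub>R 1 + b *\<^sub>R i) \<and>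
          (\<forall>a b. norm (a *\<^sub>R 1 + b *\<^sub>R i) = sqrt (a\<^sup>2 + b\<^sup>2)))"

instance real :: real_or_complex
  by standard auto

instance complex :: real_or_complex
proof
  have "\<exists>a b. x = a *\<^sub>R 1 + b *\<^sub>R \<i>" for x :: complex
    by (rule exI[of _ "Re x"], rule exI[of _ "Im x"]) (simp add: complex_eq_iff)
  moreover have "norm (a *\<^sub>R 1 + b *\<^sub>R \<i>) = sqrt (a\<^sup>2 + b\<^sup>2)" for a b
    by (simp add: cmod_def)
  ultimately show "(\<forall>x::complex. \<exists>a. x = a *\<^sub>R 1) \<or>
     (\<exists>i::complex. i * i = - 1 \<and> (\<forall>x. \<exists>a b. x = a *\<^sub>R 1 + b *\<^sub>R i) \<and>
          (\<forall>a b. norm (a *\<^sub>R 1 + b *\<^sub>R i) = sqrt (a\<^sup>2 + b\<^sup>2)))"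
    by (intro disjI2 exI[of _ "\<i>"]) auto
qed

text \<open>
  A normed space over \<open>'k\<close> is a real normed space of the library together with a compatible
  multiplication by scalars in \<open>'k\<close>. For \<open>'k = real\<close> the only such multiplication is \<open>scaleR\<close>.
  Banach spaces over \<open>'k\<close> arise when the underlying type is of class \<open>banach\<close>.
\<close>

locale normed_space_over = vector_space scale
  for scale :: "'k::real_or_complex \<Rightarrow> 'e::real_normed_vector \<Rightarrow> 'e" +
  assumes norm_scale: "norm (scale c x) = norm c * norm x"
    and scale_of_real: "scale (of_real a) x = a *\<^sub>R x"


section \<open>The Banach space of absolutely summable sequences\<close>

typedef (overloaded) 'k ell1 = "{f :: nat \<Rightarrow> 'k::real_normed_vector. summable (\<lambda>n. norm (f n))}"
  morphisms ell1_nth Abs_ell1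
  by (rule exI[of _ "\<lambda>_. 0"]) simp

setup_lifting type_definition_ell1

lemma ell1_eqI: "(\<And>n. ell1_nth x n = ell1_nth y n) \<Longrightarrow> x = y"
  by transfer auto

lemma summable_ell1_nth: "summable (\<lambda>n. norm (ell1_nth x n))"
  using ell1_nth[of x] by simp

lemma summable_norm_add:
  fixes f g :: "nat \<Rightarrow> 'a::real_normed_vector"
  assumes "summable (\<lambda>n. norm (f n))" "summable (\<lambda>n. norm (g n))"
  shows "summable (\<lambda>n. norm (f n + g n))"
  by (rule summable_comparison_test'[OF summable_add[OF assms], where N = 0])
    (simp add: norm_triangle_ineq)

lemma summable_norm_diff:
  fixes f g :: "nat \<Rightarrow> 'a::real_normed_vector"
  assumes "summable (\<lambda>n. norm (f n))" "summable (\<lambda>n. norm (g n))"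
  shows "summable (\<lambda>n. norm (f n - g n))"
  using summable_norm_add[of f "\<lambda>n. - g n"] assms by simp

instantiation ell1 :: (real_normed_vector) real_normed_vector
begin

lift_definition zero_ell1 :: "'a ell1" is "\<lambda>_. 0" by simp

lift_definition plus_ell1 :: "'a ell1 \<Rightarrow> 'a ell1 \<Rightarrow> 'a ell1" is "\<lambda>f g n. f n + g n"
  by (rule summable_norm_add)

lift_definition uminus_ell1 :: "'a ell1 \<Rightarrow> 'a ell1" is "\<lambda>f n. - f n" by simp

lift_definition minus_ell1 :: "'a ell1 \<Rightarrow> 'a ell1 \<Rightarrow> 'a ell1" is "\<lambda>f g n. f n - g n"
  by (rule summable_norm_diff)

lift_definition scaleR_ell1 :: "real \<Rightarrow> 'a ell1 \<Rightarrow> 'a ell1" is "\<lambda>c f n. c *\<^sub>R f n"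
  by (simp add: summable_mult)

lift_definition norm_ell1 :: "'a ell1 \<Rightarrow> real" is "\<lambda>f. \<Sum>n. norm (f n)" .

definition dist_ell1 :: "'a ell1 \<Rightarrow> 'a ell1 \<Rightarrow> real" where
  "dist_ell1 x y = norm (x - y)"

definition sgn_ell1 :: "'a ell1 \<Rightarrow> 'a ell1" where
  "sgn_ell1 x = inverse (norm x) *\<^sub>R x"

definition uniformity_ell1 :: "('a ell1 \<times> 'a ell1) filter" where
  "uniformity_ell1 = (INF e\<in>{0<..}. principal {(x, y). dist x y < e})"

definition open_ell1 :: "'a ell1 set \<Rightarrow> bool" where
  "open_ell1 U = (\<forall>x\<in>U. \<forall>\<^sub>F (x', y) in uniformity. x' = x \<longrightarrow> y \<in> U)"

instance
proof
  fix x y z :: "'a ell1" and a b :: real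
  show "x + y + z = x + (y + z)" by transfer (simp add: add.assoc)
  show "x + y = y + x" by transfer (simp add: add.commute)
  show "0 + x = x" by transfer simp
  show "- x + x = 0" by transfer simp
  show "x - y = x + - y" by transfer simp
  show "a *\<^sub>R (x + y) = a *\<^sub>R x + a *\<^sub>R y" by transfer (simp add: scaleR_add_right)
  show "(a + b) *\<^sub>R x = a *\<^sub>R x + b *\<^sub>R x" by transfer (simp add: scaleR_add_left)
  show "a *\<^sub>R b *\<^sub>R x = (a * b) *\<^sub>R x" by transfer simp
  show "1 *\<^sub>R x = x" by transfer simp
  show "dist x y = norm (x - y)" by (rule dist_ell1_def)
  show "sgn x = inverse (norm x) *\<^sub>R x" by (rule sgn_ell1_def)
  show "uniformity = (INF e\<in>{0<..}. principal {(x, y::'a ell1). dist x y < e})"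
    by (rule uniformity_ell1_def)
  show "open U = (\<forall>x\<in>U. \<forall>\<^sub>F (x', y) in uniformity. x' = x \<longrightarrow> y \<in> U)" for U :: "'a ell1 set"
    by (rule open_ell1_def)
  show "(norm x = 0) = (x = 0)"
    by transfer (auto simp: suminf_eq_zero_iff fun_eq_iff)
  show "norm (x + y) \<le> norm x + norm y"
  proof transfer
    fix f g :: "nat \<Rightarrow> 'a"
    assume *: "summable (\<lambda>n. norm (f n))" "summable (\<lambda>n. norm (g n))"
    have "(\<Sum>n. norm (f n + g n)) \<le> (\<Sum>n. norm (f n) + norm (g n))"
      by (intro suminf_le summable_add summable_norm_add * norm_triangle_ineq)
    then show "(\<Sum>n. norm (f n + g n)) \<le> (\<Sum>n. norm (f n)) + (\<Sum>n. norm (g n))"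
      by (simp add: suminf_add *)
  qed
  show "norm (a *\<^sub>R x) = \<bar>a\<bar> * norm x"
    by transfer (simp add: suminf_mult)
qed

end

lemma norm_ell1_eq: "norm x = (\<Sum>n. norm (ell1_nth x n))"
  by (rule norm_ell1.rep_eq)

lemma sum_norm_ell1_nth_le: "(\<Sum>n<N. norm (ell1_nth x n)) \<le> norm x"
  unfolding norm_ell1_eq by (rule sum_le_suminf) (auto simp: summable_ell1_nth)

lemma norm_ell1_nth_le: "norm (ell1_nth x n) \<le> norm x"
proof -
  have "norm (ell1_nth x n) \<le> (\<Sum>k<Suc n. norm (ell1_nth x k))"
    by (rule member_le_sum) auto
  also have "\<dots> \<le> norm x" by (rule sum_norm_ell1_nth_le)
  finally show ?thesis .
qed

instance ell1 :: (banach) banach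
proof
  fix X :: "nat \<Rightarrow> 'a ell1"
  assume X: "Cauchy X"
  have "Cauchy (\<lambda>k. ell1_nth (X k) n)" for n
  proof (rule CauchyI)
    fix e :: real assume "e > 0"
    then obtain M where M: "\<And>k l. k \<ge> M \<Longrightarrow> l \<ge> M \<Longrightarrow> norm (X k - X l) < e"
      using CauchyD[OF X] by blast
    have "norm (ell1_nth (X k) n - ell1_nth (X l) n) < e" if "k \<ge> M" "l \<ge> M" for k l
      using norm_ell1_nth_le[of "X k - X l" n] M[OF that] by (simp add: minus_ell1.rep_eq)
    then show "\<exists>M. \<forall>k\<ge>M. \<forall>l\<ge>M. norm (ell1_nth (X k) n - ell1_nth (X l) n) < e" by blast
  qed
  then have "\<forall>n. \<exists>l. (\<lambda>k. ell1_nth (X k) n) \<longlonglongrightarrow> l"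
    using Cauchy_convergent_iff convergent_def by blast
  then obtain g where g: "\<And>n. (\<lambda>k. ell1_nth (X k) n) \<longlonglongrightarrow> g n" by metis
  have approx: "\<exists>M. \<forall>k\<ge>M. \<forall>N. (\<Sum>n<N. norm (ell1_nth (X k) n - g n)) \<le> e" if e: "e > 0" for e
  proof -
    obtain M where M: "\<And>k l. k \<ge> M \<Longrightarrow> l \<ge> M \<Longrightarrow> norm (X k - X l) < e"
      using CauchyD[OF X e] by blast
    have "(\<Sum>n<N. norm (ell1_nth (X k) n - g n)) \<le> e" if k: "k \<ge> M" for k N
    proof (rule LIMSEQ_le_const2)
      show "(\<lambda>l. \<Sum>n<N. norm (ell1_nth (X k) n - ell1_nth (X l) n))
              \<longlonglongrightarrow> (\<Sum>n<N. norm (ell1_nth (X k) n - g n))"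
        by (intro tendsto_sum tendsto_norm tendsto_diff tendsto_const g)
      have "(\<Sum>n<N. norm (ell1_nth (X k) n - ell1_nth (X l) n)) \<le> e" if "l \<ge> M" for l
        using sum_norm_ell1_nth_le[of "X k - X l" N] M[OF k that] by (simp add: minus_ell1.rep_eq)
      then show "\<exists>M. \<forall>l\<ge>M. (\<Sum>n<N. norm (ell1_nth (X k) n - ell1_nth (X l) n)) \<le> e" by blast
    qed
    then show ?thesis by blast
  qed
  have summable_diff: "summable (\<lambda>n. norm (ell1_nth (X k) n - g n))"
    if "\<forall>N. (\<Sum>n<N. norm (ell1_nth (X k) n - g n)) \<le> e" for k e
    by (rule summableI_nonneg_bounded[of _ e]) (use that in auto)
  obtain k where "\<forall>N. (\<Sum>n<N. norm (ell1_nth (X k) n - g n)) \<le> 1"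
    using approx[of 1] by auto
  from summable_norm_diff[OF summable_ell1_nth[of "X k"] summable_diff[OF this]]
  have "summable (\<lambda>n. norm (g n))" by simp
  then have G: "ell1_nth (Abs_ell1 g) = g" by (simp add: Abs_ell1_inverse)
  have "X \<longlonglongrightarrow> Abs_ell1 g"
  proof (rule LIMSEQ_I)
    fix r :: real assume "r > 0"
    then obtain M where M: "\<And>k N. k \<ge> M \<Longrightarrow> (\<Sum>n<N. norm (ell1_nth (X k) n - g n)) \<le> r / 2"
      using approx[of "r / 2"] by auto
    have "norm (X k - Abs_ell1 g) \<le> r / 2" if "k \<ge> M" for k
      unfolding norm_ell1_eq minus_ell1.rep_eq G
      by (rule suminf_le_const) (use M[OF that] summable_diff in blast)+
    then show "\<exists>M. \<forall>k\<ge>M. norm (X k - Abs_ell1 g) < r"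
      using \<open>r > 0\<close> by (intro exI[of _ M]) fastforce
  qed
  then show "convergent X" by (rule convergentI)
qed

lift_definition scale_ell1 :: "'k::real_normed_field \<Rightarrow> 'k ell1 \<Rightarrow> 'k ell1" is "\<lambda>c f n. c * f n"
  by (simp add: norm_mult summable_mult)

interpretation ell1: normed_space_over "scale_ell1 :: 'k::real_or_complex \<Rightarrow> 'k ell1 \<Rightarrow> 'k ell1"
proof
  fix a b :: 'k and x y :: "'k ell1" and r :: real
  show "scale_ell1 a (x + y) = scale_ell1 a x + scale_ell1 a y" by transfer (simp add: algebra_simps)
  show "scale_ell1 (a + b) x = scale_ell1 a x + scale_ell1 b x" by transfer (simp add: algebra_simps)
  show "scale_ell1 a (scale_ell1 b x) = scale_ell1 (a * b) x" by transfer (simp add: algebra_simps)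
  show "scale_ell1 1 x = x" by transfer simp
  show "norm (scale_ell1 a x) = norm a * norm x" by transfer (simp add: norm_mult suminf_mult)
  show "scale_ell1 (of_real r) x = r *\<^sub>R x" by transfer (simp add: scaleR_conv_of_real)
qed


section \<open>Summing multilinear operators\<close>

definition dual_ball :: "('k::real_or_complex \<Rightarrow> 'e::real_normed_vector \<Rightarrow> 'e) \<Rightarrow> ('e \<Rightarrow> 'k) set" where
  "dual_ball sE = {\<phi>. Vector_Spaces.linear sE (*) \<phi> \<and> bounded_linear \<phi> \<and> onorm \<phi> \<le> 1}"

text \<open>Finite families are indexed by \<open>0, \<dots>, N - 1\<close>. The supremum is over a nonempty set of reals
  bounded above by the sum of the norms of the \<open>x j\<close>.\<close>

definition weak1_norm ::
  "('k::real_or_complex \<Rightarrow> 'e::real_normed_vector \<Rightarrow> 'e) \<Rightarrow> nat \<Rightarrow> (nat \<Rightarrow> 'e) \<Rightarrow> real" where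
  "weak1_norm sE N x = (SUP \<phi>\<in>dual_ball sE. \<Sum>j<N. norm (\<phi> (x j)))"

text \<open>The \<open>m\<close>-th power of \<open>E\<close> is \<open>'m \<Rightarrow> 'e\<close> with \<open>m = CARD('m)\<close>, carrying the product topology.\<close>

definition multilinear_maps ::
  "('k::real_or_complex \<Rightarrow> 'e::real_normed_vector \<Rightarrow> 'e) \<Rightarrow>
   ('k \<Rightarrow> 'f::real_normed_vector \<Rightarrow> 'f) \<Rightarrow> (('m::finite \<Rightarrow> 'e) \<Rightarrow> 'f) set" where
  "multilinear_maps sE sF =
     {T. (\<forall>q x. Vector_Spaces.linear sE sF (\<lambda>y. T (x(q := y)))) \<and> continuous_on UNIV T}"

definition abs_summing_maps ::
  "real \<Rightarrow> ('k::real_or_complex \<Rightarrow> 'e::real_normed_vector \<Rightarrow> 'e) \<Rightarrow>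
   ('k \<Rightarrow> 'f::real_normed_vector \<Rightarrow> 'f) \<Rightarrow> (('m::finite \<Rightarrow> 'e) \<Rightarrow> 'f) set" where
  "abs_summing_maps r sE sF =
     {T \<in> multilinear_maps sE sF.
        \<exists>C\<ge>0. \<forall>N. \<forall>x :: 'm \<Rightarrow> nat \<Rightarrow> 'e.
          (\<Sum>j<N. norm (T (\<lambda>q. x q j)) powr r) powr (1 / r) \<le> C * (\<Prod>q\<in>UNIV. weak1_norm sE N (x q))}"


section \<open>Uniform finite representability\<close>

text \<open>\<open>'k\<^sup>n\<close> is realised as the sequences vanishing from index \<open>n\<close> on.\<close>

definition Kn :: "nat \<Rightarrow> (nat \<Rightarrow> 'k::real_or_complex) set" where
  "Kn n = {a. \<forall>i\<ge>n. a i = 0}"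

definition lp_norm :: "ereal \<Rightarrow> nat \<Rightarrow> (nat \<Rightarrow> 'k::real_or_complex) \<Rightarrow> real" where
  "lp_norm p n a =
     (if p = \<infinity> then Max ((\<lambda>i. norm (a i)) ` {..<n})
      else (\<Sum>i<n. norm (a i) powr real_of_ereal p) powr (1 / real_of_ereal p))"

definition lp_unif_fin_representable ::
  "ereal \<Rightarrow> ('k::real_or_complex \<Rightarrow> 'f::real_normed_vector \<Rightarrow> 'f) \<Rightarrow> bool" where
  "lp_unif_fin_representable p sF \<longleftrightarrow>
     (\<exists>D\<ge>1. \<forall>n\<ge>1. \<exists>Fn J.
        module.subspace sF Fn \<and>
        bij_betw J (Kn n) Fn \<and>
        (\<forall>a\<in>Kn n. \<forall>b\<in>Kn n. J (\<lambda>i. a i + b i) = J a + J b) \<and>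
        (\<forall>c. \<forall>a\<in>Kn n. J (\<lambda>i. c * a i) = sF c (J a)) \<and>
        (\<forall>a\<in>Kn n. norm (J a) \<le> lp_norm p n a) \<and>
        (\<forall>y\<in>Fn. lp_norm p n (inv_into (Kn n) J y) \<le> D * norm y))"

definition r_crit :: "nat \<Rightarrow> ereal \<Rightarrow> real" where
  "r_crit m p =
     (if p = \<infinity> then 2 / real m
      else let s = real_of_ereal p in
        if s \<le> 2 then 2 * s / (real m * s + 2 * s - 2) else 2 * s / (real m * s + 2))"

end

theory Submission
  imports Defs
begin

text \<open>
  Let \<open>n = 2\<^sup>d\<close>, and let \<open>\<chi>\<^sub>0, \<dots>, \<chi>\<^sub>n\<^sub>-\<^sub>1\<close> be the characters of the group of bit vectors of length
  \<open>d\<close>. As vectors of \<open>\<ell>\<^sub>1\<^sup>n\<close> they have weak \<open>1\<close>-norm at most \<open>n\<^bsup>3/2\<^esup>\<close>, by Parseval and Cauchy-Schwarz.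
  They are tested against two \<open>m\<close>-linear maps from \<open>\<ell>\<^sub>1\<^sup>n\<close> to \<open>\<ell>\<^sub>p\<^sup>n\<close> of norm at most \<open>1\<close>.
  The convolution \<open>x\<^sub>1 * \<dots> * x\<^sub>m\<close> maps \<open>(\<chi>\<^sub>k, \<dots>, \<chi>\<^sub>k)\<close> to \<open>n\<^bsup>m-1\<^esup> \<chi>\<^sub>k\<close>, of norm \<open>n\<^bsup>m-1+1/p\<^esup>\<close>; the Fourier
  transform of the convolution, multiplied by \<open>n\<^bsup>-1/p\<^esup>\<close>, takes there a value of norm \<open>n\<^bsup>m-1/p\<^esup>\<close>.
  If the values have norm \<open>n\<^sup>s\<close>, comparing powers of \<open>n\<close> in the summing inequality yields
  \<open>s + 1/r \<le> 3m/2\<close>. The convolution is the better choice for \<open>p \<le> 2\<close>, its transform for \<open>p \<ge> 2\<close>.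
  Block number \<open>d\<close> of \<open>\<ell>\<^sub>1\<close> consists of the indices from \<open>2\<^sup>d\<close> to \<open>2\<^bsup>d+1\<^esup> - 1\<close>.
\<close>


section \<open>Walsh functions\<close>

text \<open>The Sylvester-Hadamard matrix of order \<open>2 ^ d\<close>: with one index fixed, it is
  a character of the group of bit vectors in the other.\<close>

definition walsh :: "nat \<Rightarrow> nat \<Rightarrow> nat \<Rightarrow> real" where
  "walsh d i j = (\<Prod>b<d. if bit i b \<and> bit j b then - 1 else 1)"

lemma walsh_commute: "walsh d i j = walsh d j i"
  by (simp add: walsh_def conj_commute)

lemma walsh_mult_self: "walsh d i j * walsh d i j = 1"
  unfolding walsh_def prod.distrib[symmetric] by (intro prod.neutral) auto

lemma abs_walsh: "\<bar>walsh d i j\<bar> = 1"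
  unfolding walsh_def abs_prod by (intro prod.neutral) auto

lemma walsh_xor: "walsh d (Bit_Operations.xor i i') j = walsh d i j * walsh d i' j"
  unfolding walsh_def prod.distrib[symmetric] by (intro prod.cong) (auto simp: bit_xor_iff)

lemma walsh_power_of_2:
  assumes "b < d"
  shows "walsh d (2 ^ b) j = (if bit j b then - 1 else 1)"
proof -
  have "walsh d (2 ^ b) j = (\<Prod>c<d. if c = b then (if bit j b then - 1 else 1) else 1)"
    unfolding walsh_def by (intro prod.cong) (auto simp: bit_exp_iff)
  with assms show ?thesis by simp
qed

lemma xor_less_power_of_2:
  fixes i j :: nat
  assumes "i < 2 ^ d" "j < 2 ^ d"
  shows "Bit_Operations.xor i j < 2 ^ d"
  using assms by (simp add: take_bit_nat_eq_self_iff[symmetric])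

text \<open>Translation by a group element permutes the index set and is its own inverse.\<close>

lemma sum_xor:
  fixes i :: nat
  assumes "i < 2 ^ d"
  shows "(\<Sum>l<2 ^ d. f (Bit_Operations.xor l i)) = (\<Sum>l<2 ^ d. f l)"
  by (rule sum.reindex_bij_witness[where i = "\<lambda>l. Bit_Operations.xor l i" and j = "\<lambda>l. Bit_Operations.xor l i"])
    (auto simp: xor_less_power_of_2 assms xor.assoc)

lemma walsh_orthogonal:
  assumes "j < 2 ^ d" "k < 2 ^ d"
  shows "(\<Sum>i<2 ^ d. walsh d i j * walsh d i k) = (if j = k then 2 ^ d else 0)"
proof (cases "j = k")
  case True
  then show ?thesis by (simp add: walsh_mult_self)
next
  case False
  \<comment> \<open>Translating the summation index by \<open>2 ^ b\<close>, for a bit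
    \<open>b\<close> in which \<open>j\<close> and \<open>k\<close> differ, changes the sign of
    every term, so the sum equals its own negative.\<close>
  then obtain b where b: "bit j b \<noteq> bit k b" by (auto simp: bit_eq_iff)
  have "take_bit d j = j" "take_bit d k = k" using assms by (simp_all add: take_bit_nat_eq_self_iff)
  with b have "b < d" by (metis bit_take_bit_iff)
  let ?f = "\<lambda>i. walsh d i j * walsh d i k"
  have "(\<Sum>i<2 ^ d. ?f i) = (\<Sum>i<2 ^ d. ?f (Bit_Operations.xor i (2 ^ b)))"
    by (rule sum_xor[symmetric]) (use \<open>b < d\<close> in simp)
  also have "\<dots> = (\<Sum>i<2 ^ d. - ?f i)"
    using b by (intro sum.cong) (auto simp: walsh_xor walsh_power_of_2 \<open>b < d\<close>)
  finally show ?thesis using False by (simp add: sum_negf)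
qed

text \<open>No normalising factor is included, so the transform is inverted by applying it again and
  dividing by \<open>2 ^ d\<close>.\<close>

definition walsh_transform :: "nat \<Rightarrow> (nat \<Rightarrow> 'k::real_normed_field) \<Rightarrow> nat \<Rightarrow> 'k" where
  "walsh_transform d a j = (\<Sum>i<2 ^ d. of_real (walsh d i j) * a i)"

lemma norm_walsh_transform_le: "norm (walsh_transform d a j) \<le> (\<Sum>i<2 ^ d. norm (a i))"
  unfolding walsh_transform_def by (rule sum_norm_le) (simp add: norm_mult abs_walsh)

lemma walsh_transform_walsh:
  assumes "j < 2 ^ d" "k < 2 ^ d"
  shows "walsh_transform d (\<lambda>i. of_real (walsh d i k)) j = (if j = k then 2 ^ d else 0 :: 'k::real_normed_field)"
proof -
  have "walsh_transform d (\<lambda>i. of_real (walsh d i k)) j =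
      (of_real :: real \<Rightarrow> 'k) (\<Sum>i<2 ^ d. walsh d i j * walsh d i k)"
    unfolding walsh_transform_def by simp
  then show ?thesis by (simp add: walsh_orthogonal assms)
qed

text \<open>The inverse transform of a pointwise product is a convolution over the group of bit vectors
  under exclusive or; this is why the \<open>\<ell>\<^sub>1\<close>-norm is submultiplicative here.\<close>

lemma sum_norm_inverse_walsh_transform_prod_le:
  fixes a :: "'q \<Rightarrow> nat \<Rightarrow> 'k::real_normed_field"
  assumes "finite Q"
  shows "(\<Sum>l<2 ^ d. norm (walsh_transform d (\<lambda>j. \<Prod>q\<in>Q. walsh_transform d (a q) j) l / 2 ^ d))
    \<le> (\<Prod>q\<in>Q. \<Sum>i<2 ^ d. norm (a q i))"
  using assms
proof (induction Q rule: finite_induct)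
  case empty
  \<comment> \<open>The constant function is the character of index 0; its inverse transform is the
    unit of convolution, of norm 1.\<close>
  have "walsh_transform d (\<lambda>j. 1) l / 2 ^ d = (if l = 0 then 1 else 0 :: 'k)" if "l < 2 ^ d" for l
  proof -
    have "walsh_transform d (\<lambda>j. 1 :: 'k) l = walsh_transform d (\<lambda>i. of_real (walsh d i 0)) l"
      by (simp add: walsh_def)
    with that show ?thesis by (simp add: walsh_transform_walsh)
  qed
  then have "(\<Sum>l<2 ^ d. norm (walsh_transform d (\<lambda>j. 1 :: 'k) l / 2 ^ d)) = (\<Sum>l<(2::nat) ^ d. if l = 0 then 1 else 0)"
    by (intro sum.cong) auto
  also have "\<dots> = (1 :: real)" by simp
  finally show ?case by simp
next
  case (insert q Q)
  \<comment> \<open>\<open>c\<close> is the convolution of the families indexed by \<open>Q\<close>;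
    \<open>conv\<close> adds one more factor by means of the character property
    \<open>walsh_xor\<close>.\<close>
  define c where "c l = walsh_transform d (\<lambda>j. \<Prod>q\<in>Q. walsh_transform d (a q) j) l / 2 ^ d" for l
  have conv: "walsh_transform d (\<lambda>j. \<Prod>q\<in>insert q Q. walsh_transform d (a q) j) l / 2 ^ d
      = (\<Sum>i<2 ^ d. a q i * c (Bit_Operations.xor l i))" for l
  proof -
    let ?P = "\<lambda>j. \<Prod>q\<in>Q. walsh_transform d (a q) j"
    have "walsh_transform d (\<lambda>j. \<Prod>q\<in>insert q Q. walsh_transform d (a q) j) l
        = (\<Sum>j<2 ^ d. \<Sum>i<2 ^ d. of_real (walsh d j l) * (of_real (walsh d i j) * a q i * ?P j))"
      by (subst walsh_transform_def)
        (simp add: insert.hyps walsh_transform_def[of d "a q"] sum_distrib_left sum_distrib_right)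
    also have "\<dots> = (\<Sum>i<2 ^ d. \<Sum>j<2 ^ d. of_real (walsh d j l) * (of_real (walsh d i j) * a q i * ?P j))"
      by (rule sum.swap)
    also have "\<dots> = (\<Sum>i<2 ^ d. a q i * walsh_transform d ?P (Bit_Operations.xor l i))"
      unfolding walsh_transform_def[of d ?P] sum_distrib_left
      by (intro sum.cong refl)
        (simp add: walsh_commute[of d _ l] walsh_commute[of d _ "Bit_Operations.xor _ _"] walsh_xor)
    finally show ?thesis by (simp add: c_def sum_divide_distrib)
  qed
  \<comment> \<open>After the triangle inequality the inner sum over \<open>l\<close> is independent
    of \<open>i\<close>, by translation invariance.\<close>
  have "(\<Sum>l<2 ^ d. norm (\<Sum>i<2 ^ d. a q i * c (Bit_Operations.xor l i)))
      \<le> (\<Sum>l<2 ^ d. \<Sum>i<2 ^ d. norm (a q i) * norm (c (Bit_Operations.xor l i)))"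
    by (intro sum_mono sum_norm_le) (simp add: norm_mult)
  also have "\<dots> = (\<Sum>i<2 ^ d. norm (a q i) * (\<Sum>l<2 ^ d. norm (c (Bit_Operations.xor l i))))"
    by (subst sum.swap) (simp add: sum_distrib_left)
  also have "\<dots> = (\<Sum>i<2 ^ d. norm (a q i)) * (\<Sum>l<2 ^ d. norm (c l))"
    by (simp add: sum_distrib_right sum_xor[of _ d "\<lambda>l. norm (c l)"])
  also have "\<dots> \<le> (\<Sum>i<2 ^ d. norm (a q i)) * (\<Prod>q\<in>Q. \<Sum>i<2 ^ d. norm (a q i))"
    using insert.IH unfolding c_def by (intro mult_left_mono) (auto intro: sum_nonneg)
  finally show ?case unfolding conv using insert.hyps by simp
qed

section \<open>Parseval's identity and the exponent 3/2\<close>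

lemma walsh_parseval_real:
  "(\<Sum>k<2 ^ d. (\<Sum>i<2 ^ d. walsh d i k * a i)\<^sup>2) = 2 ^ d * (\<Sum>i<2 ^ d. (a i)\<^sup>2)"
proof -
  have "(\<Sum>k<2 ^ d. (\<Sum>i<2 ^ d. walsh d i k * a i)\<^sup>2)
      = (\<Sum>k<2 ^ d. \<Sum>i<2 ^ d. \<Sum>j<2 ^ d. walsh d i k * a i * (walsh d j k * a j))"
    by (simp add: power2_eq_square sum_product)
  also have "\<dots> = (\<Sum>i<2 ^ d. \<Sum>j<2 ^ d. \<Sum>k<2 ^ d. walsh d i k * a i * (walsh d j k * a j))"
    by (subst sum.swap, rule sum.cong[OF refl], rule sum.swap)
  \<comment> \<open>The innermost sum is now an inner product of two characters, so only
    \<open>i = j\<close> survives.\<close>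
  also have "\<dots> = (\<Sum>i<2 ^ d. \<Sum>j<2 ^ d. a i * a j * (\<Sum>k<2 ^ d. walsh d k i * walsh d k j))"
    by (simp add: sum_distrib_left walsh_commute[of d _ "_ :: nat"] mult_ac)
  also have "\<dots> = (\<Sum>i<2 ^ d. \<Sum>j<2 ^ d. if i = j then 2 ^ d * (a i)\<^sup>2 else 0)"
    by (intro sum.cong refl) (auto simp: walsh_orthogonal power2_eq_square)
  also have "\<dots> = 2 ^ d * (\<Sum>i<2 ^ d. (a i)\<^sup>2)"
    by (simp add: sum_distrib_left)
  finally show ?thesis .
qed

text \<open>The Walsh matrix is real, so over the complex field the transform acts separately on
  real and imaginary parts, whose squares add up to the squared modulus.\<close>

lemma walsh_parseval:
  fixes a :: "nat \<Rightarrow> 'k::real_or_complex"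
  shows "(\<Sum>k<2 ^ d. (norm (walsh_transform d a k))\<^sup>2) = 2 ^ d * (\<Sum>i<2 ^ d. (norm (a i))\<^sup>2)"
proof -
  consider "\<forall>x::'k. \<exists>s. x = s *\<^sub>R 1"
    | w where "\<forall>x::'k. \<exists>s t. x = s *\<^sub>R 1 + t *\<^sub>R w" "\<forall>s t. norm (s *\<^sub>R 1 + t *\<^sub>R w) = sqrt (s\<^sup>2 + t\<^sup>2)"
    using real_or_complex[where 'a = 'k] by blast
  then show ?thesis
  proof cases
    case 1
    then have "\<forall>i. \<exists>s. a i = s *\<^sub>R 1" by blast
    from choice[OF this] obtain s where s: "\<And>i. a i = s i *\<^sub>R 1" by blast
    have "walsh_transform d a k = (\<Sum>i<2 ^ d. walsh d i k * s i) *\<^sub>R 1" for k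
      by (simp add: walsh_transform_def s scaleR_conv_of_real)
    then show ?thesis using walsh_parseval_real[of d s] by (simp add: s)
  next
    case 2
    then have "\<forall>i. \<exists>s t. a i = s *\<^sub>R 1 + t *\<^sub>R w" by blast
    from choice[OF this] obtain s where "\<forall>i. \<exists>t. a i = s i *\<^sub>R 1 + t *\<^sub>R w" by blast
    from choice[OF this] obtain t where st: "\<And>i. a i = s i *\<^sub>R 1 + t i *\<^sub>R w" by blast
    have "walsh_transform d a k
        = (\<Sum>i<2 ^ d. walsh d i k * s i) *\<^sub>R 1 + (\<Sum>i<2 ^ d. walsh d i k * t i) *\<^sub>R w" for k
      by (simp add: walsh_transform_def st scaleR_conv_of_real algebra_simps sum.distrib sum_distrib_left)
    then show ?thesis using walsh_parseval_real[of d s] walsh_parseval_real[of d t]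
      by (simp add: st 2(2) sum.distrib distrib_left)
  qed
qed

text \<open>With \<open>n = 2 ^ d\<close>, Cauchy-Schwarz against the constant 1 costs a factor
  \<open>n\<close>, and Parseval bounds the sum of squares by \<open>n * n\<close>; the square root
  of \<open>n ^ 3\<close> remains.\<close>

lemma sum_norm_walsh_transform_le:
  fixes a :: "nat \<Rightarrow> 'k::real_or_complex"
  assumes "\<And>i. i < 2 ^ d \<Longrightarrow> norm (a i) \<le> 1"
  shows "(\<Sum>k<2 ^ d. norm (walsh_transform d a k)) \<le> (2 ^ d) powr (3 / 2)"
proof -
  have "(\<Sum>k<2 ^ d. norm (walsh_transform d a k))\<^sup>2 \<le> 2 ^ d * (\<Sum>k<2 ^ d. (norm (walsh_transform d a k))\<^sup>2)"
    using Cauchy_Schwarz_ineq_sum[of "\<lambda>_. 1" "\<lambda>k. norm (walsh_transform d a k)" "{..<2 ^ d}"] by simp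
  also have "\<dots> \<le> 2 ^ d * (2 ^ d * (\<Sum>i<(2::nat) ^ d. 1))"
    unfolding walsh_parseval by (intro mult_left_mono sum_mono) (auto simp: assms power_le_one)
  also have "\<dots> = ((2 ^ d) powr (3 / 2))\<^sup>2"
    by (simp add: powr_powr powr_numeral flip: powr_numeral[of "_ powr _"]) (simp add: power3_eq_cube)
  finally show ?thesis by (rule power2_le_imp_le) simp
qed

section \<open>Multilinear maps\<close>

lemma normed_space_over_mult: "normed_space_over ((*) :: 'k::real_or_complex \<Rightarrow> 'k \<Rightarrow> 'k)"
  by standard (auto simp: algebra_simps norm_mult scaleR_conv_of_real)

context normed_space_over
begin

lemma bounded_linear_scale_right: "bounded_linear (scale c)"
proof (rule bounded_linear_intro[where K = "norm c"])
  show "scale c (a *\<^sub>R x) = a *\<^sub>R scale c x" for a x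
    by (simp flip: scale_of_real add: scale_left_commute)
qed (simp_all add: scale_right_distrib norm_scale)

lemma bounded_linear_scale_left: "bounded_linear (\<lambda>c. scale c x)"
proof (rule bounded_linear_intro[where K = "norm x"])
  show "scale (a *\<^sub>R c) x = a *\<^sub>R scale c x" for a c
    by (simp flip: scale_of_real add: scaleR_conv_of_real)
qed (simp_all add: scale_left_distrib norm_scale)

end

lemma multilinear_maps_iff:
  assumes "normed_space_over sE" "normed_space_over sF"
  shows "T \<in> multilinear_maps sE sF \<longleftrightarrow>
    (\<forall>q x y z. T (x(q := y + z)) = T (x(q := y)) + T (x(q := z))) \<and>
    (\<forall>q x c y. T (x(q := sE c y)) = sF c (T (x(q := y)))) \<and> continuous_on UNIV T"
  using assms[THEN normed_space_over.axioms(1)]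
  by (auto simp: multilinear_maps_def Vector_Spaces.linear_iff)

lemma multilinear_maps_prod:
  fixes sE :: "'k::real_or_complex \<Rightarrow> 'e::real_normed_vector \<Rightarrow> 'e"
  assumes "normed_space_over sE"
    and lin: "\<And>q. Vector_Spaces.linear sE (*) (f q)" and cont: "\<And>q. continuous_on UNIV (f q)"
  shows "(\<lambda>x :: 'm::finite \<Rightarrow> 'e. \<Prod>q\<in>UNIV. f q (x q)) \<in> multilinear_maps sE (*)"
proof -
  have upd: "(\<Prod>q'\<in>UNIV. f q' ((x(q := y)) q')) = f q y * (\<Prod>q'\<in>UNIV - {q}. f q' (x q'))"
    for x :: "'m \<Rightarrow> 'e" and q y
    by (subst prod.remove[of _ q]) auto
  have "continuous_on UNIV (\<lambda>x :: 'm \<Rightarrow> 'e. f q (x q))" for q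
    by (rule continuous_on_compose2[OF cont continuous_on_product_coordinates]) auto
  then have "continuous_on UNIV (\<lambda>x :: 'm \<Rightarrow> 'e. \<Prod>q\<in>UNIV. f q (x q))"
    by (rule continuous_on_prod)
  with lin show ?thesis
    unfolding multilinear_maps_iff[OF assms(1) normed_space_over_mult] upd
    by (auto simp: Vector_Spaces.linear_iff algebra_simps)
qed

text \<open>Serves two purposes: attaching a vector of the target space to a scalar form and, with
  the field itself as target, multiplying a form by a constant.\<close>

lemma multilinear_maps_scale:
  assumes "normed_space_over sE" "normed_space_over sF" "g \<in> multilinear_maps sE (*)"
  shows "(\<lambda>x. sF (g x) u) \<in> multilinear_maps sE sF"
proof -
  interpret F: normed_space_over sF by fact
  have "continuous_on UNIV (\<lambda>x. sF (g x) u)"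
    using assms(3) unfolding multilinear_maps_def
    by (intro bounded_linear.continuous_on[OF F.bounded_linear_scale_left]) auto
  with assms(3) show ?thesis
    by (simp add: multilinear_maps_iff assms(1,2) normed_space_over_mult F.scale_left_distrib)
qed

lemma multilinear_maps_sum:
  assumes "normed_space_over sE" "normed_space_over sF" "\<And>i. i \<in> A \<Longrightarrow> T i \<in> multilinear_maps sE sF"
  shows "(\<lambda>x. \<Sum>i\<in>A. T i x) \<in> multilinear_maps sE sF"
proof -
  interpret F: normed_space_over sF by fact
  have "continuous_on UNIV (\<lambda>x. \<Sum>i\<in>A. T i x)"
    using assms(3) by (intro continuous_on_sum) (auto simp: multilinear_maps_def)
  moreover have "(\<Sum>i\<in>A. T i (x(q := y + z))) = (\<Sum>i\<in>A. T i (x(q := y))) + (\<Sum>i\<in>A. T i (x(q := z)))" for x q y z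
    using assms(3) by (simp add: multilinear_maps_iff assms(1,2) flip: sum.distrib)
  moreover have "(\<Sum>i\<in>A. T i (x(q := sE c y))) = sF c (\<Sum>i\<in>A. T i (x(q := y)))" for x q y c
    using assms(3) by (simp add: multilinear_maps_iff assms(1,2) F.scale_sum_right)
  ultimately show ?thesis by (simp add: multilinear_maps_iff assms(1,2))
qed

text \<open>The series converges absolutely at each point by comparison with \<open>w\<close>, so
  the algebraic identities pass to the limit; continuity follows from uniform convergence near each
  point.\<close>

lemma multilinear_maps_suminf:
  fixes sE :: "'k::real_or_complex \<Rightarrow> 'e::real_normed_vector \<Rightarrow> 'e"
    and sF :: "'k \<Rightarrow> 'f::banach \<Rightarrow> 'f"
    and T :: "nat \<Rightarrow> ('m::finite \<Rightarrow> 'e) \<Rightarrow> 'f"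
  assumes "normed_space_over sE" "normed_space_over sF" and T: "\<And>d. T d \<in> multilinear_maps sE sF"
    and le: "\<And>d x. norm (T d x) \<le> (\<Prod>q\<in>UNIV. norm (x q))"
    and w: "\<And>d. 0 \<le> w d" "summable w"
  shows "(\<lambda>x. \<Sum>d. w d *\<^sub>R T d x) \<in> multilinear_maps sE sF"
proof -
  interpret F: normed_space_over sF by fact
  have le': "norm (w d *\<^sub>R T d x) \<le> w d * (\<Prod>q\<in>UNIV. norm (x q))" for d x
    using mult_left_mono[OF le w(1)] by (simp add: w(1))
  have summable: "summable (\<lambda>d. w d *\<^sub>R T d x)" for x
    by (rule summable_comparison_test'[OF summable_mult2[OF w(2)] le'])
  have "(\<Sum>d. w d *\<^sub>R T d (x(q := y + z))) = (\<Sum>d. w d *\<^sub>R T d (x(q := y))) + (\<Sum>d. w d *\<^sub>R T d (x(q := z)))" for x q y z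
    unfolding suminf_add[OF summable summable]
    using T by (simp add: multilinear_maps_iff assms(1,2) scaleR_add_right)
  moreover have "(\<Sum>d. w d *\<^sub>R T d (x(q := sE c y))) = sF c (\<Sum>d. w d *\<^sub>R T d (x(q := y)))" for x q y c
    unfolding bounded_linear.suminf[OF F.bounded_linear_scale_right summable]
    using T by (simp add: multilinear_maps_iff assms(1,2) F.scale_left_commute mult.commute flip: F.scale_of_real)
  moreover have "continuous_on UNIV (\<lambda>x. \<Sum>d. w d *\<^sub>R T d x)"
    unfolding continuous_on_eq_continuous_at[OF open_UNIV]
  proof
    fix a :: "'m \<Rightarrow> 'e"
    \<comment> \<open>An open neighbourhood of \<open>a\<close> on which the product of the norms is
      bounded, as the Weierstrass test requires.\<close>
    define U :: "('m \<Rightarrow> 'e) set" where "U = (\<Inter>q. (\<lambda>x. x q) -` {y. norm y < norm (a q) + 1})"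
    have "open U" unfolding U_def
      by (intro open_INT ballI open_vimage open_Collect_less continuous_intros continuous_on_product_coordinates) auto
    have "a \<in> U" by (simp add: U_def)
    have cont: "continuous_on UNIV (T d)" for d
      using T by (auto simp: multilinear_maps_def)
    have "continuous_on U (\<lambda>x. \<Sum>d. w d *\<^sub>R T d x)"
    proof (rule uniform_limit_theorem)
      show "\<forall>\<^sub>F n in sequentially. continuous_on U (\<lambda>x. \<Sum>d<n. w d *\<^sub>R T d x)"
        by (intro always_eventually allI continuous_intros continuous_on_subset[OF cont]) auto
      show "uniform_limit U (\<lambda>n x. \<Sum>d<n. w d *\<^sub>R T d x) (\<lambda>x. \<Sum>d. w d *\<^sub>R T d x) sequentially"
      proof (rule Weierstrass_m_test)
        show "summable (\<lambda>d. w d * (\<Prod>q\<in>UNIV. norm (a q) + 1))" by (rule summable_mult2[OF w(2)])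
        show "norm (w d *\<^sub>R T d x) \<le> w d * (\<Prod>q\<in>UNIV. norm (a q) + 1)" if "x \<in> U" for d x
        proof -
          have "(\<Prod>q\<in>UNIV. norm (x q)) \<le> (\<Prod>q\<in>UNIV. norm (a q) + 1)"
            using that by (intro prod_mono) (auto simp: U_def less_imp_le)
          then show ?thesis using le'[of d x] mult_left_mono[OF _ w(1)] order_trans by blast
        qed
      qed
    qed simp
    with \<open>open U\<close> \<open>a \<in> U\<close> show "isCont (\<lambda>x. \<Sum>d. w d *\<^sub>R T d x) a"
      by (simp add: continuous_on_eq_continuous_at)
  qed
  ultimately show ?thesis by (simp add: multilinear_maps_iff assms(1,2))
qed

section \<open>Test vectors in dyadic blocks\<close>

lift_definition ell1_unit :: "nat \<Rightarrow> 'k::real_normed_field ell1" is "\<lambda>i n. if n = i then 1 else 0"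
  by (rule summable_finite[of "{_}"]) auto

lemma norm_ell1_unit: "norm (ell1_unit i :: 'k::real_normed_field ell1) = 1"
proof -
  have "(\<lambda>n. norm (ell1_nth (ell1_unit i :: 'k ell1) n)) = (\<lambda>n. if n = i then 1 else 0)"
    by (auto simp: ell1_unit.rep_eq)
  then show ?thesis
    using sums_single[of i "\<lambda>_. 1 :: real"] by (simp add: norm_ell1_eq sums_unique[symmetric])
qed

lemma ell1_nth_sum: "ell1_nth (\<Sum>i\<in>A. f i) n = (\<Sum>i\<in>A. ell1_nth (f i) n)"
  by (induction A rule: infinite_finite_induct) (auto simp: zero_ell1.rep_eq plus_ell1.rep_eq)

lemma bounded_linear_ell1_nth: "bounded_linear (\<lambda>x. ell1_nth x n)"
  by (rule bounded_linear_intro[where K = 1])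
    (auto simp: plus_ell1.rep_eq scaleR_ell1.rep_eq norm_ell1_nth_le)

text \<open>The offset \<open>2 ^ d\<close> is the start of block \<open>d\<close>. Distinct blocks
  are disjoint, so maps for all \<open>d\<close> can share one sequence space without
  interfering.\<close>

definition block_transform :: "nat \<Rightarrow> 'k::real_normed_field ell1 \<Rightarrow> nat \<Rightarrow> 'k" where
  "block_transform d x = walsh_transform d (\<lambda>i. ell1_nth x (2 ^ d + i))"

definition walsh_vector :: "nat \<Rightarrow> nat \<Rightarrow> 'k::real_normed_field ell1" where
  "walsh_vector d k = (\<Sum>i<2 ^ d. scale_ell1 (of_real (walsh d i k)) (ell1_unit (2 ^ d + i)))"

lemma sum_norm_block_le: "(\<Sum>i<2 ^ d. norm (ell1_nth x (2 ^ d + i))) \<le> norm x"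
proof -
  have "(\<Sum>i<2 ^ d. norm (ell1_nth x (2 ^ d + i))) = (\<Sum>i\<in>(+) (2 ^ d) ` {..<2 ^ d}. norm (ell1_nth x i))"
    by (simp add: sum.reindex)
  also have "\<dots> \<le> (\<Sum>i<2 ^ d + 2 ^ d. norm (ell1_nth x i))"
    by (rule sum_mono2) auto
  also have "\<dots> \<le> norm x" by (rule sum_norm_ell1_nth_le)
  finally show ?thesis .
qed

lemma norm_block_transform_le: "norm (block_transform d x j) \<le> norm x"
  unfolding block_transform_def by (rule order_trans[OF norm_walsh_transform_le sum_norm_block_le])

lemma linear_block_transform:
  "Vector_Spaces.linear scale_ell1 (*) (\<lambda>x :: 'k::real_or_complex ell1. block_transform d x j)"
  unfolding Vector_Spaces.linear_iff
  using ell1.vector_space_axioms normed_space_over_mult[THEN normed_space_over.axioms(1)]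
  by (auto simp: block_transform_def walsh_transform_def plus_ell1.rep_eq scale_ell1.rep_eq
      distrib_left sum.distrib sum_distrib_left mult.left_commute)

lemma continuous_block_transform: "continuous_on UNIV (\<lambda>x. block_transform d x j)"
  unfolding block_transform_def walsh_transform_def
  by (intro continuous_intros bounded_linear.continuous_on[OF bounded_linear_ell1_nth])

lemma block_transform_walsh_vector:
  assumes "j < 2 ^ d" "k < 2 ^ d"
  shows "block_transform d (walsh_vector d k) j = (if j = k then 2 ^ d else 0 :: 'k::real_normed_field)"
proof -
  have "ell1_nth (walsh_vector d k :: 'k ell1) (2 ^ d + i) = of_real (walsh d i k)" if "i < 2 ^ d" for i
    using that unfolding walsh_vector_def ell1_nth_sum scale_ell1.rep_eq ell1_unit.rep_eq
    by (simp add: if_distrib[of "(*) _"] cong: if_cong)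
  then have "block_transform d (walsh_vector d k :: 'k ell1) j = walsh_transform d (\<lambda>i. of_real (walsh d i k)) j"
    unfolding block_transform_def walsh_transform_def by (intro sum.cong) auto
  then show ?thesis by (simp add: walsh_transform_walsh assms)
qed

text \<open>The common index is at least \<open>2 ^ d\<close> and below \<open>2 ^ Suc d'\<close>,
  and likewise with \<open>d\<close> and \<open>d'\<close> exchanged; hence neither exponent exceeds
  the other.\<close>

lemma dyadic_blocks_disjoint:
  fixes i i' :: nat
  assumes "2 ^ d + i = 2 ^ d' + i'" "i < 2 ^ d" "i' < 2 ^ d'"
  shows "d = d'"
proof -
  have "2 ^ d < (2 :: nat) ^ Suc d'" "2 ^ d' < (2 :: nat) ^ Suc d" using assms by simp_all
  then show ?thesis by (simp add: power_strict_increasing_iff del: power_Suc)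
qed

lemma block_transform_walsh_vector_other:
  assumes "d' \<noteq> d"
  shows "block_transform d' (walsh_vector d k) j = (0 :: 'k::real_normed_field)"
proof -
  have "ell1_nth (walsh_vector d k :: 'k ell1) (2 ^ d' + i) = 0" if "i < 2 ^ d'" for i
    unfolding walsh_vector_def ell1_nth_sum scale_ell1.rep_eq ell1_unit.rep_eq
    using assms dyadic_blocks_disjoint[OF _ that] by (intro sum.neutral) fastforce
  then show ?thesis by (simp add: block_transform_def walsh_transform_def)
qed

text \<open>A functional of norm at most 1 is bounded by 1 on the unit vectors, and its values on
  the Walsh vectors are the transform of these data, so \<open>sum_norm_walsh_transform_le\<close>
  applies.\<close>

lemma weak1_norm_walsh_vector:
  "0 \<le> weak1_norm scale_ell1 (2 ^ d) (walsh_vector d :: nat \<Rightarrow> 'k::real_or_complex ell1)"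
  "weak1_norm scale_ell1 (2 ^ d) (walsh_vector d :: nat \<Rightarrow> 'k ell1) \<le> (2 ^ d) powr (3 / 2)"
proof -
  let ?S = "\<lambda>\<phi> :: 'k ell1 \<Rightarrow> 'k. \<Sum>j<2 ^ d. norm (\<phi> (walsh_vector d j))"
  \<comment> \<open>The zero functional makes the ball nonempty, as \<open>cSUP_least\<close>
    requires, and shows that the supremum is nonnegative.\<close>
  have zero: "(\<lambda>_. 0) \<in> dual_ball (scale_ell1 :: 'k \<Rightarrow> _)"
    using ell1.vector_space_axioms normed_space_over_mult[THEN normed_space_over.axioms(1)]
    by (auto simp: dual_ball_def Vector_Spaces.linear_iff onorm_zero)
  have le: "?S \<phi> \<le> (2 ^ d) powr (3 / 2)" if "\<phi> \<in> dual_ball scale_ell1" for \<phi>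
  proof -
    have \<phi>: "Vector_Spaces.linear scale_ell1 (*) \<phi>" "bounded_linear \<phi>" "onorm \<phi> \<le> 1"
      using that by (auto simp: dual_ball_def)
    have "norm (\<phi> (ell1_unit i)) \<le> 1" for i
      using onorm[OF \<phi>(2), of "ell1_unit i"] \<phi>(3) by (simp add: norm_ell1_unit)
    then have "(\<Sum>k<2 ^ d. norm (walsh_transform d (\<lambda>i. \<phi> (ell1_unit (2 ^ d + i))) k)) \<le> (2 ^ d) powr (3 / 2)"
      by (intro sum_norm_walsh_transform_le)
    moreover have "\<phi> (walsh_vector d k) = walsh_transform d (\<lambda>i. \<phi> (ell1_unit (2 ^ d + i))) k" for k
      using \<phi>(1) unfolding walsh_vector_def walsh_transform_def linear_sum[OF bounded_linear.linear[OF \<phi>(2)]]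
      by (simp add: Vector_Spaces.linear_iff)
    ultimately show ?thesis by simp
  qed
  show "weak1_norm scale_ell1 (2 ^ d) (walsh_vector d :: nat \<Rightarrow> 'k ell1) \<le> (2 ^ d) powr (3 / 2)"
    unfolding weak1_norm_def by (rule cSUP_least) (use zero le in auto)
  have "?S (\<lambda>_. 0) \<le> weak1_norm scale_ell1 (2 ^ d) (walsh_vector d :: nat \<Rightarrow> 'k ell1)"
    unfolding weak1_norm_def by (rule cSUP_upper[OF zero bdd_aboveI2[OF le]])
  then show "0 \<le> weak1_norm scale_ell1 (2 ^ d) (walsh_vector d :: nat \<Rightarrow> 'k ell1)" by simp
qed

section \<open>The lower bound for the summing exponent\<close>

lemma lp_norm_cong: "(\<And>i. i < n \<Longrightarrow> a i = b i) \<Longrightarrow> lp_norm p n a = lp_norm p n b"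
  by (simp add: lp_norm_def)

text \<open>The vectors \<open>u n l\<close> are the images of the unit vectors under the given
  isomorphism, which is thereby replaced by finite sums.\<close>

lemma lp_unif_fin_representable_basis:
  fixes sF :: "'k::real_or_complex \<Rightarrow> 'f::real_normed_vector \<Rightarrow> 'f"
  assumes "normed_space_over sF" "lp_unif_fin_representable p sF"
  shows "\<exists>D\<ge>1. \<exists>u. \<forall>n\<ge>1. \<forall>c. norm (\<Sum>l<n. sF (c l) (u n l)) \<le> lp_norm p n c \<and>
      lp_norm p n c \<le> D * norm (\<Sum>l<n. sF (c l) (u n l))"
proof -
  interpret F: normed_space_over sF by fact
  from assms(2) obtain D where "D \<ge> 1" and
    rep: "\<And>n. n \<ge> 1 \<Longrightarrow> \<exists>Fn J.
        F.subspace Fn \<and> bij_betw J (Kn n) Fn \<and>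
        (\<forall>a\<in>Kn n. \<forall>b\<in>Kn n. J (\<lambda>i. a i + b i) = J a + J b) \<and>
        (\<forall>c. \<forall>a\<in>Kn n. J (\<lambda>i. c * a i) = sF c (J a)) \<and>
        (\<forall>a\<in>Kn n. norm (J a) \<le> lp_norm p n a) \<and>
        (\<forall>y\<in>Fn. lp_norm p n (inv_into (Kn n) J y) \<le> D * norm y)"
    unfolding lp_unif_fin_representable_def by blast
  have "\<exists>u. \<forall>c. norm (\<Sum>l<n. sF (c l) (u l)) \<le> lp_norm p n c \<and>
      lp_norm p n c \<le> D * norm (\<Sum>l<n. sF (c l) (u l))" if "n \<ge> 1" for n
  proof -
    from rep[OF that] obtain Fn J where J: "bij_betw J (Kn n) Fn"
      "\<And>a b. a \<in> Kn n \<Longrightarrow> b \<in> Kn n \<Longrightarrow> J (\<lambda>i. a i + b i) = J a + J b"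
      "\<And>c a. a \<in> Kn n \<Longrightarrow> J (\<lambda>i. c * a i) = sF c (J a)"
      "\<And>a. a \<in> Kn n \<Longrightarrow> norm (J a) \<le> lp_norm p n a"
      "\<And>y. y \<in> Fn \<Longrightarrow> lp_norm p n (inv_into (Kn n) J y) \<le> D * norm y"
      by blast
    define e :: "nat \<Rightarrow> nat \<Rightarrow> 'k" where "e l i = (if i = l then 1 else 0)" for l i
    \<comment> \<open>The induction runs through truncations, which stay in \<open>Kn n\<close>:
      additivity and homogeneity of \<open>J\<close> are given only there.\<close>
    have expand: "J (\<lambda>i. if i < k then c i else 0) = (\<Sum>l<k. sF (c l) (J (e l)))" if "k \<le> n" for k c
      using that
    proof (induction k)
      case 0
      \<comment> \<open>Writing zero as \<open>0 * 0\<close> lets homogeneity show that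
        \<open>J\<close> vanishes at zero.\<close>
      have "J (\<lambda>i. 0 * 0) = sF 0 (J (\<lambda>_. 0))" by (rule J(3)) (simp add: Kn_def)
      then show ?case by simp
    next
      case (Suc k)
      have split: "(\<lambda>i. if i < Suc k then c i else 0) = (\<lambda>i. (if i < k then c i else 0) + c k * e k i)"
        by (auto simp: e_def less_Suc_eq)
      have "J (\<lambda>i. if i < Suc k then c i else 0) = J (\<lambda>i. if i < k then c i else 0) + J (\<lambda>i. c k * e k i)"
        unfolding split using Suc.prems by (intro J(2)) (auto simp: Kn_def e_def)
      also have "J (\<lambda>i. c k * e k i) = sF (c k) (J (e k))"
        using Suc.prems by (intro J(3)) (auto simp: Kn_def e_def)
      finally show ?case using Suc by simp
    qed
    have "norm (\<Sum>l<n. sF (c l) (J (e l))) \<le> lp_norm p n c \<and>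
      lp_norm p n c \<le> D * norm (\<Sum>l<n. sF (c l) (J (e l)))" for c
    proof -
      let ?c = "\<lambda>i. if i < n then c i else 0"
      have K: "?c \<in> Kn n" by (simp add: Kn_def)
      have c: "lp_norm p n ?c = lp_norm p n c" by (rule lp_norm_cong) simp
      have "inv_into (Kn n) J (J ?c) = ?c" "J ?c \<in> Fn"
        using J(1) K by (auto simp: bij_betw_def)
      with J(4)[OF K] J(5)[of "J ?c"] show ?thesis by (simp add: expand c)
    qed
    then show ?thesis by (intro exI[of _ "\<lambda>l. J (e l)"] allI)
  qed
  then have "\<forall>n. \<exists>u. n \<ge> 1 \<longrightarrow> (\<forall>c. norm (\<Sum>l<n. sF (c l) (u l)) \<le> lp_norm p n c \<and>
      lp_norm p n c \<le> D * norm (\<Sum>l<n. sF (c l) (u l)))" by blast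
  from choice[OF this] \<open>D \<ge> 1\<close> show ?thesis by blast
qed

lemma powr_power_of_2: "(2 ^ d :: real) powr a = (2 powr a) ^ d"
  by (simp add: powr_powr mult.commute flip: powr_realpow)

lemma exponent_le_0_if_bounded:
  assumes "\<And>d. (2 ^ d) powr a \<le> (B :: real)"
  shows "a \<le> 0"
proof (rule ccontr)
  assume "\<not> a \<le> 0"
  then have "1 < (2 :: real) powr a" by simp
  then obtain d where "B < (2 powr a) ^ d" using real_arch_pow by blast
  with assms[of d] show False by (simp add: powr_power_of_2)
qed

text \<open>The hypothesis gives a separate summing constant for each map, so the maps of all block sizes
  are added up into a single one; the weights \<open>n powr - \<epsilon>\<close> cost only an arbitrarily small power
  of the block size.\<close>

lemma summing_exponent_bound:
  fixes sF :: "'k::real_or_complex \<Rightarrow> 'f::banach \<Rightarrow> 'f"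
    and G :: "nat \<Rightarrow> nat \<Rightarrow> ('m::finite \<Rightarrow> 'k ell1) \<Rightarrow> 'k"
  assumes F: "normed_space_over sF" and rep: "lp_unif_fin_representable p sF" and "0 < r"
    and eq: "(multilinear_maps scale_ell1 sF :: (('m \<Rightarrow> 'k ell1) \<Rightarrow> 'f) set)
           = abs_summing_maps r scale_ell1 sF"
    and G: "\<And>d l. G d l \<in> multilinear_maps scale_ell1 (*)"
    and G_le: "\<And>d x. lp_norm p (2 ^ d) (\<lambda>l. G d l x) \<le> (\<Prod>q\<in>UNIV. norm (x q))"
    and G_other: "\<And>d d' k l. d' \<noteq> d \<Longrightarrow> G d' l (\<lambda>_. walsh_vector d k) = 0"
    and G_ge: "\<And>d k. k < 2 ^ d \<Longrightarrow> (2 ^ d) powr s \<le> lp_norm p (2 ^ d) (\<lambda>l. G d l (\<lambda>_. walsh_vector d k))"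
  shows "s + 1 / r \<le> 3 / 2 * real CARD('m)"
proof (rule field_le_epsilon)
  fix \<epsilon> :: real assume "0 < \<epsilon>"
  interpret F: normed_space_over sF by fact
  obtain D u where "D \<ge> 1"
    and u_le: "\<And>n c. n \<ge> 1 \<Longrightarrow> norm (\<Sum>l<n. sF (c l) (u n l)) \<le> lp_norm p n c"
    and u_ge: "\<And>n c. n \<ge> 1 \<Longrightarrow> lp_norm p n c \<le> D * norm (\<Sum>l<n. sF (c l) (u n l))"
    using lp_unif_fin_representable_basis[OF F rep] by blast
  define t where "t d x = (\<Sum>l<2 ^ d. sF (G d l x) (u (2 ^ d) l))" for d x
  define w :: "nat \<Rightarrow> real" where "w d = (2 ^ d) powr - \<epsilon>" for d
  define T where "T x = (\<Sum>d. w d *\<^sub>R t d x)" for x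
  have t: "t d \<in> multilinear_maps scale_ell1 sF" for d
    unfolding t_def
    by (intro multilinear_maps_sum multilinear_maps_scale ell1.normed_space_over_axioms F G)
  have t_le: "norm (t d x) \<le> (\<Prod>q\<in>UNIV. norm (x q))" for d x
    unfolding t_def by (rule order_trans[OF u_le G_le]) simp
  have w: "0 \<le> w d" for d by (simp add: w_def)
  have "(\<lambda>d. w d) = (\<lambda>d. (2 powr - \<epsilon>) ^ d)" by (simp add: w_def powr_power_of_2)
  moreover have "summable (\<lambda>d. (2 powr - \<epsilon>) ^ d)"
    by (rule summable_geometric) (use \<open>0 < \<epsilon>\<close> in \<open>simp add: powr_less_one\<close>)
  ultimately have "summable w" by simp
  from multilinear_maps_suminf[OF ell1.normed_space_over_axioms F t t_le w this]
  have "T \<in> multilinear_maps scale_ell1 sF" unfolding T_def .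
  then have "T \<in> abs_summing_maps r scale_ell1 sF" by (simp only: eq)
  then obtain C where "C \<ge> 0" and C': "\<forall>N x. (\<Sum>j<N. norm (T (\<lambda>q. x q j)) powr r) powr (1 / r)
      \<le> C * (\<Prod>q\<in>UNIV. weak1_norm scale_ell1 N (x q))"
    unfolding abs_summing_maps_def mem_Collect_eq by (elim conjE exE)
  have C: "(\<Sum>j<N. norm (T (\<lambda>q. x q j)) powr r) powr (1 / r)
      \<le> C * (\<Prod>q\<in>UNIV. weak1_norm scale_ell1 N (x q))" for N x
    by (rule C'[rule_format])
  have "(2 ^ d) powr (s + 1 / r - \<epsilon> - 3 / 2 * real CARD('m)) \<le> C * D" for d
  proof -
    define n :: real where "n = 2 ^ d"
    have "n > 0" by (simp add: n_def)
    \<comment> \<open>The factors of this lower bound come from the weight of block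
      \<open>d\<close>, from \<open>G_ge\<close>, and from the distortion \<open>D\<close> of the
      copy in the target space.\<close>
    define v where "v = n powr - \<epsilon> * (n powr s / D)"
    have "v \<ge> 0" using \<open>D \<ge> 1\<close> by (simp add: v_def)
    have v_le: "v \<le> norm (T (\<lambda>_. walsh_vector d k))" if "k < 2 ^ d" for k
    proof -
      have "t d' (\<lambda>_. walsh_vector d k) = 0" if "d' \<noteq> d" for d'
        using G_other[OF that] by (simp add: t_def)
      \<comment> \<open>The maps of all other blocks vanish on this vector, so the series reduces to
        one term.\<close>
      then have "T (\<lambda>_. walsh_vector d k) = (\<Sum>d'\<in>{d}. w d' *\<^sub>R t d' (\<lambda>_. walsh_vector d k))"
        unfolding T_def by (intro suminf_finite) auto
      then have T: "norm (T (\<lambda>_. walsh_vector d k)) = w d * norm (t d (\<lambda>_. walsh_vector d k))"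
        by (simp add: w_def)
      have "n powr s \<le> D * norm (t d (\<lambda>_. walsh_vector d k))"
        unfolding t_def n_def by (rule order_trans[OF G_ge u_ge]) (use that in auto)
      then have "n powr s / D \<le> norm (t d (\<lambda>_. walsh_vector d k))"
        using \<open>D \<ge> 1\<close> by (simp add: field_simps)
      then show ?thesis unfolding T v_def w_def n_def by (intro mult_left_mono) auto
    qed
    \<comment> \<open>The summing inequality is tested on the \<open>n\<close> Walsh vectors of
      block \<open>d\<close>, with the same family in all slots; each of the \<open>n\<close> values
      has norm at least \<open>v\<close>.\<close>
    have "n powr (1 / r) * v = (n * v powr r) powr (1 / r)"
      using \<open>v \<ge> 0\<close> \<open>0 < r\<close> \<open>n > 0\<close> by (simp add: powr_mult powr_powr)
    also have "n * v powr r = (\<Sum>k<(2::nat) ^ d. v powr r)" by (simp add: n_def)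
    also have "\<dots> powr (1 / r) \<le> (\<Sum>k<2 ^ d. norm (T (\<lambda>_. walsh_vector d k)) powr r) powr (1 / r)"
      using v_le \<open>v \<ge> 0\<close> \<open>0 < r\<close> by (intro powr_mono2 sum_mono sum_nonneg) auto
    also have "\<dots> \<le> C * (\<Prod>q\<in>(UNIV :: 'm set). weak1_norm scale_ell1 (2 ^ d) (walsh_vector d :: nat \<Rightarrow> 'k ell1))"
      by (rule C)
    also have "\<dots> \<le> C * (n powr (3 / 2)) ^ CARD('m)"
      unfolding n_def using \<open>C \<ge> 0\<close> weak1_norm_walsh_vector
      by (auto intro!: mult_left_mono power_mono)
    also have "(n powr (3 / 2)) ^ CARD('m) = n powr (3 / 2 * real CARD('m))"
      using \<open>n > 0\<close> by (simp add: powr_powr flip: powr_realpow)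
    finally have "n powr (1 / r) * (n powr - \<epsilon> * n powr s) \<le> C * D * n powr (3 / 2 * real CARD('m))"
      using \<open>D \<ge> 1\<close> by (simp add: v_def field_simps)
    moreover have "n powr (1 / r) * (n powr - \<epsilon> * n powr s) = n powr (s + 1 / r - \<epsilon>)"
      by (simp add: algebra_simps flip: powr_add)
    ultimately show ?thesis
      unfolding n_def[symmetric] powr_diff[of n "s + 1 / r - \<epsilon>"] using \<open>n > 0\<close> by (simp add: divide_le_eq)
  qed
  from exponent_le_0_if_bounded[OF this]
  show "s + 1 / r \<le> 3 / 2 * real CARD('m) + \<epsilon>" by simp
qed

section \<open>The two families of test maps\<close>

lemma prod_block_transform_multilinear:
  "(\<lambda>x :: 'm::finite \<Rightarrow> 'k::real_or_complex ell1. (\<Prod>q\<in>UNIV. block_transform d (x q) j)) \<in> multilinear_maps scale_ell1 (*)"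
  by (intro multilinear_maps_prod ell1.normed_space_over_axioms linear_block_transform continuous_block_transform)

text \<open>With \<open>S\<close> the sum on the right, each entry is at most \<open>S\<close>, so
  its power \<open>p\<close> is at most \<open>S powr (p - 1)\<close> times the entry; these bounds
  add up to \<open>S powr p\<close>.\<close>

lemma lp_norm_le_sum:
  assumes "1 \<le> p"
  shows "lp_norm (ereal p) n c \<le> (\<Sum>i<n. norm (c i))"
proof -
  define S where "S = (\<Sum>i<n. norm (c i))"
  have "S \<ge> 0" by (simp add: S_def sum_nonneg)
  have le: "norm (c i) \<le> S" if "i < n" for i
    unfolding S_def by (rule member_le_sum) (use that in auto)
  have "(\<Sum>i<n. norm (c i) powr p) \<le> (\<Sum>i<n. norm (c i) * S powr (p - 1))"
  proof (rule sum_mono)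
    fix i assume "i \<in> {..<n}"
    have "norm (c i) powr p = norm (c i) * norm (c i) powr (p - 1)"
      by (cases "c i = 0") (auto simp: powr_mult_base)
    also have "\<dots> \<le> norm (c i) * S powr (p - 1)"
      using le \<open>i \<in> _\<close> assms by (intro mult_left_mono powr_mono2) auto
    finally show "norm (c i) powr p \<le> norm (c i) * S powr (p - 1)" .
  qed
  also have "\<dots> = S powr p"
    using \<open>S \<ge> 0\<close> by (simp add: S_def[symmetric] powr_mult_base flip: sum_distrib_right)
  finally have "(\<Sum>i<n. norm (c i) powr p) powr (1 / p) \<le> (S powr p) powr (1 / p)"
    using assms by (intro powr_mono2) (auto intro: sum_nonneg)
  then show ?thesis using \<open>S \<ge> 0\<close> assms by (simp add: lp_norm_def powr_powr S_def)
qed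

text \<open>\<open>\<kappa>\<close> is 1/p with the convention that it is 0 at infinity, which lets
  finite and infinite \<open>p\<close> share one formula.\<close>

lemma lp_norm_le_const:
  assumes "n \<ge> 1" "1 \<le> p" "\<And>i. i < n \<Longrightarrow> norm (c i) \<le> B"
    and \<kappa>: "\<kappa> = (if p = \<infinity> then 0 else 1 / real_of_ereal p)"
  shows "lp_norm p n c \<le> real n powr \<kappa> * B"
proof (cases "p = \<infinity>")
  case True
  with assms show ?thesis by (auto simp: lp_norm_def lessThan_empty_iff intro!: Max.boundedI)
next
  case False
  then obtain s where p: "p = ereal s" and "s \<ge> 1" using assms(2) by (cases p) auto
  have "B \<ge> 0" using order_trans[OF norm_ge_zero assms(3)[of 0]] assms(1) by simp
  have "(\<Sum>i<n. norm (c i) powr s) \<le> (\<Sum>i<n. B powr s)"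
    using assms(3) \<open>s \<ge> 1\<close> by (intro sum_mono powr_mono2) auto
  then have "(\<Sum>i<n. norm (c i) powr s) powr (1 / s) \<le> (real n * B powr s) powr (1 / s)"
    using \<open>s \<ge> 1\<close> by (intro powr_mono2) (auto intro: sum_nonneg)
  also have "\<dots> = real n powr (1 / s) * B"
    using \<open>s \<ge> 1\<close> \<open>B \<ge> 0\<close> by (simp add: powr_mult powr_powr)
  finally show ?thesis by (simp add: lp_norm_def \<kappa> p)
qed

lemma norm_le_lp_norm:
  assumes "1 \<le> p" "k < n"
  shows "norm (c k) \<le> lp_norm p n c"
proof (cases "p = \<infinity>")
  case True
  with assms show ?thesis by (auto simp: lp_norm_def)
next
  case False
  then obtain s where p: "p = ereal s" and "s \<ge> 1" using assms(1) by (cases p) auto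
  have "norm (c k) = (norm (c k) powr s) powr (1 / s)"
    using \<open>s \<ge> 1\<close> by (simp add: powr_powr)
  also have "\<dots> \<le> (\<Sum>i<n. norm (c i) powr s) powr (1 / s)"
    using assms(2) \<open>s \<ge> 1\<close> by (intro powr_mono2 member_le_sum[of k "{..<n}" "\<lambda>i. norm (c i) powr s"]) auto
  finally show ?thesis by (simp add: lp_norm_def p)
qed

lemma summing_exponent_bound_diagonal:
  fixes sF :: "'k::real_or_complex \<Rightarrow> 'f::banach \<Rightarrow> 'f"
  assumes F: "normed_space_over sF" and "1 \<le> p" and rep: "lp_unif_fin_representable p sF" and "0 < r"
    and eq: "(multilinear_maps scale_ell1 sF :: (('m::finite \<Rightarrow> 'k ell1) \<Rightarrow> 'f) set)
           = abs_summing_maps r scale_ell1 sF"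
    and \<kappa>: "\<kappa> = (if p = \<infinity> then 0 else 1 / real_of_ereal p)"
  shows "1 / r \<le> real CARD('m) / 2 + \<kappa>"
proof -
  \<comment> \<open>The factor \<open>(2 ^ d) powr - \<kappa>\<close> compensates for passing from
    the maximum of \<open>2 ^ d\<close> coordinates to the \<open>p\<close>-norm, so that the norm
    bound holds with constant 1.\<close>
  define G where "G d l x = (\<Prod>q\<in>UNIV. block_transform d (x q) l) * of_real ((2 ^ d) powr - \<kappa>)"
    for d l and x :: "'m \<Rightarrow> 'k ell1"
  have "real CARD('m) - \<kappa> + 1 / r \<le> 3 / 2 * real CARD('m)"
  proof (rule summing_exponent_bound[OF F rep \<open>0 < r\<close> eq, of G])
    show "G d l \<in> multilinear_maps scale_ell1 (*)" for d l
      unfolding G_def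
      by (rule multilinear_maps_scale[OF ell1.normed_space_over_axioms normed_space_over_mult
            prod_block_transform_multilinear])
    show "lp_norm p (2 ^ d) (\<lambda>l. G d l x) \<le> (\<Prod>q\<in>UNIV. norm (x q))" for d x
    proof -
      have "lp_norm p (2 ^ d) (\<lambda>l. G d l x)
          \<le> real (2 ^ d) powr \<kappa> * ((\<Prod>q\<in>UNIV. norm (x q)) * (2 ^ d) powr - \<kappa>)"
      proof (rule lp_norm_le_const[OF _ \<open>1 \<le> p\<close> _ \<kappa>])
        show "norm (G d l x) \<le> (\<Prod>q\<in>UNIV. norm (x q)) * (2 ^ d) powr - \<kappa>" for l
          unfolding G_def by (simp add: norm_mult flip: prod_norm)
            (intro mult_right_mono prod_mono conjI norm_block_transform_le, auto)
      qed simp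
      also have "\<dots> = (\<Prod>q\<in>UNIV. norm (x q))" by (simp add: powr_minus)
      finally show ?thesis .
    qed
    show "G d' l (\<lambda>_. walsh_vector d k) = 0" if "d' \<noteq> d" for d d' k l
      by (simp add: G_def block_transform_walsh_vector_other[OF that] card_gt_0_iff)
    show "(2 ^ d) powr (real CARD('m) - \<kappa>) \<le> lp_norm p (2 ^ d) (\<lambda>l. G d l (\<lambda>_. walsh_vector d k))"
      if "k < 2 ^ d" for d k
    proof -
      \<comment> \<open>Coordinate \<open>k\<close> alone already has the required size: each of its
        \<open>CARD('m)\<close> block transforms equals \<open>2 ^ d\<close>.\<close>
      have "(2 ^ d) powr (real CARD('m) - \<kappa>) = (2 ^ d) ^ CARD('m) * (2 ^ d) powr - \<kappa>"
        by (simp add: powr_diff powr_minus divide_inverse powr_realpow)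
      also have "\<dots> = norm (G d k (\<lambda>_. walsh_vector d k))"
        using that by (simp add: G_def block_transform_walsh_vector norm_mult norm_power)
      also have "\<dots> \<le> lp_norm p (2 ^ d) (\<lambda>l. G d l (\<lambda>_. walsh_vector d k))"
        by (rule norm_le_lp_norm[OF \<open>1 \<le> p\<close> that])
      finally show ?thesis .
    qed
  qed
  then show ?thesis by simp
qed

lemma summing_exponent_bound_convolution:
  fixes sF :: "'k::real_or_complex \<Rightarrow> 'f::banach \<Rightarrow> 'f"
  assumes F: "normed_space_over sF" and "1 \<le> s" and rep: "lp_unif_fin_representable (ereal s) sF" and "0 < r"
    and eq: "(multilinear_maps scale_ell1 sF :: (('m::finite \<Rightarrow> 'k ell1) \<Rightarrow> 'f) set)
           = abs_summing_maps r scale_ell1 sF"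
  shows "1 / r \<le> real CARD('m) / 2 + 1 - 1 / s"
proof -
  \<comment> \<open>The convolution of the blocks, written through transforms because these are
    explicit on Walsh vectors.\<close>
  define G where "G d l x = walsh_transform d (\<lambda>j. \<Prod>q\<in>UNIV. block_transform d (x q) j) l / 2 ^ d"
    for d l and x :: "'m \<Rightarrow> 'k ell1"
  have "real CARD('m) - 1 + 1 / s + 1 / r \<le> 3 / 2 * real CARD('m)"
  proof (rule summing_exponent_bound[OF F rep \<open>0 < r\<close> eq, of G])
    show "G d l \<in> multilinear_maps scale_ell1 (*)" for d l
    proof -
      have "G d l = (\<lambda>x. \<Sum>j<2 ^ d. (\<Prod>q\<in>UNIV. block_transform d (x q) j) * (of_real (walsh d j l) / 2 ^ d))"
        by (simp add: fun_eq_iff G_def walsh_transform_def sum_divide_distrib mult.commute)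
      then show ?thesis
        by (simp only:) (intro multilinear_maps_sum multilinear_maps_scale[where sF = "(*)"]
            ell1.normed_space_over_axioms normed_space_over_mult prod_block_transform_multilinear)
    qed
    show "lp_norm (ereal s) (2 ^ d) (\<lambda>l. G d l x) \<le> (\<Prod>q\<in>UNIV. norm (x q))" for d x
    proof -
      have "lp_norm (ereal s) (2 ^ d) (\<lambda>l. G d l x) \<le> (\<Sum>l<2 ^ d. norm (G d l x))"
        by (rule lp_norm_le_sum[OF \<open>1 \<le> s\<close>])
      also have "\<dots> \<le> (\<Prod>q\<in>UNIV. \<Sum>i<2 ^ d. norm (ell1_nth (x q) (2 ^ d + i)))"
        unfolding G_def block_transform_def by (rule sum_norm_inverse_walsh_transform_prod_le) simp
      also have "\<dots> \<le> (\<Prod>q\<in>UNIV. norm (x q))"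
        by (intro prod_mono conjI sum_nonneg sum_norm_block_le) auto
      finally show ?thesis .
    qed
    show "G d' l (\<lambda>_. walsh_vector d k) = 0" if "d' \<noteq> d" for d d' k l
      by (simp add: G_def block_transform_walsh_vector_other[OF that] walsh_transform_def power_0_left)
    show "(2 ^ d) powr (real CARD('m) - 1 + 1 / s) \<le> lp_norm (ereal s) (2 ^ d) (\<lambda>l. G d l (\<lambda>_. walsh_vector d k))"
      if "k < 2 ^ d" for d k
    proof -
      \<comment> \<open>Only \<open>j = k\<close> contributes to the transform, and dividing by
        \<open>2 ^ d\<close> lowers the exponent by one. All \<open>2 ^ d\<close> coordinates have
        the same modulus, whence the additional \<open>1 / s\<close> in the exponent of the
        norm.\<close>
      have "norm (G d l (\<lambda>_. walsh_vector d k)) = (2 ^ d) powr (real CARD('m) - 1)" for l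
      proof -
        have "walsh_transform d (\<lambda>j. \<Prod>q\<in>(UNIV::'m set). block_transform d (walsh_vector d k :: 'k ell1) j) l
            = (\<Sum>j<2 ^ d. if j = k then of_real (walsh d k l) * (2 ^ d) ^ CARD('m) else 0)"
          unfolding walsh_transform_def
          using that by (intro sum.cong) (auto simp: block_transform_walsh_vector card_gt_0_iff)
        also have "\<dots> = of_real (walsh d k l) * (2 ^ d) ^ CARD('m)" using that by simp
        finally show ?thesis
          by (simp add: G_def norm_mult norm_divide norm_power abs_walsh powr_diff powr_realpow)
      qed
      then have "lp_norm (ereal s) (2 ^ d) (\<lambda>l. G d l (\<lambda>_. walsh_vector d k))
          = (2 ^ d * ((2 ^ d) powr (real CARD('m) - 1)) powr s) powr (1 / s)"
        by (simp add: lp_norm_def)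
      also have "\<dots> = (2 ^ d) powr (real CARD('m) - 1 + 1 / s)"
        using \<open>1 \<le> s\<close> by (simp add: powr_mult powr_powr powr_add)
      finally show ?thesis by simp
    qed
  qed
  then show ?thesis by simp
qed

theorem theorem5p2:
  fixes sF :: "'k::real_or_complex \<Rightarrow> 'f::banach \<Rightarrow> 'f"
    and p :: ereal and r :: real
  assumes "normed_space_over sF"
    and "1 \<le> p"
    and "lp_unif_fin_representable p sF"
    and "0 < r"
    and "(multilinear_maps scale_ell1 sF :: (('m::finite \<Rightarrow> 'k ell1) \<Rightarrow> 'f) set)
           = abs_summing_maps r scale_ell1 sF"
  shows "r_crit CARD('m) p \<le> r"
proof -
  have m: "real CARD('m) > 0" by simp
  \<comment> \<open>This bound holds for every \<open>p\<close>; it is applied below for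
    \<open>p\<close> above 2, infinity included.\<close>
  have diagonal: "1 / r \<le> real CARD('m) / 2 + (if p = \<infinity> then 0 else 1 / real_of_ereal p)"
    by (rule summing_exponent_bound_diagonal[OF assms refl])
  show ?thesis
  proof (cases p)
    case (real s)
    with assms(2) have "s \<ge> 1" by simp
    show ?thesis
    proof (cases "s \<le> 2")
      case True
      \<comment> \<open>For \<open>s \<le> 2\<close> one has \<open>1 - 1 / s \<le> 1 / s\<close>,
        so convolution gives the smaller bound for \<open>1 / r\<close>; the two bounds agree at
        \<open>s = 2\<close>.\<close>
      have "1 / r \<le> real CARD('m) / 2 + 1 - 1 / s"
        using summing_exponent_bound_convolution[OF assms(1) \<open>s \<ge> 1\<close> _ assms(4,5)] assms(3) real by simp
      also have "\<dots> = (real CARD('m) * s + 2 * s - 2) / (2 * s)"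
        using \<open>s \<ge> 1\<close> by (simp add: field_simps)
      finally have "1 / r \<le> (real CARD('m) * s + 2 * s - 2) / (2 * s)" .
      moreover have "real CARD('m) * s + 2 * s - 2 > 0"
        using \<open>s \<ge> 1\<close> mult_pos_pos[OF m, of s] by linarith
      ultimately show ?thesis
        using \<open>s \<ge> 1\<close> \<open>0 < r\<close> real True by (simp add: r_crit_def field_simps)
    next
      case False
      have "1 / r \<le> (real CARD('m) * s + 2) / (2 * s)"
        using diagonal \<open>s \<ge> 1\<close> real by (simp add: field_simps)
      moreover have "real CARD('m) * s + 2 > 0"
        using \<open>s \<ge> 1\<close> mult_pos_pos[OF m, of s] by linarith
      ultimately show ?thesis
        using \<open>s \<ge> 1\<close> \<open>0 < r\<close> real False by (simp add: r_crit_def field_simps)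
    qed
  next
    case PInf
    with diagonal m \<open>0 < r\<close> show ?thesis by (simp add: r_crit_def field_simps)
  next
    case MInf
    with assms(2) show ?thesis by simp
  qed
qed

end
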